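(* If $p=2$ and $4\alpha\leq\beta$, then the dynamical system $(S_{\beta/2}(0),f,\mu)$ is ergodic.
   Context: $p=2$; $a,b\in\mathbb{Q}_2$ with $ab\neq0$, and $\sqrt{a^2-4b}$ is assumed to exist in $\mathbb{Q}_2$. $f(x)=\frac{x^3+ax^2+bx}{ax+b}$ is considered on $\mathbb{Q}_2\setminus\{-\frac{b}{a}\}$. Let $x_1,x_2=\frac{-a\pm\sqrt{a^2-4b}}{2}\in\mathbb{Q}_2$, $\alpha=|x_1|_2$, $\beta=|x_2|_2$. $S_r(0)=\{x\in\mathbb{Q}_2:|x|_2=r\}$ and $V_\rho(c)=\{x\in\mathbb{Q}_2:|x-c|_2\leq\rho\}$. When $4\alpha\leq\beta$, the sphere $S_{\beta/2}(0)$ is invariant under $f$. With $r=\beta/2$, $\mu$ is the normalized Haar measure on (Borel subsets of) $S_r(0)$, i.e. the probability measure with $\mu(V_\rho(c))=\frac{\rho}{r(1-1/2)}$ for balls $V_\rho(c)\subset S_r(0)$ with $\rho\in\{2^n:n\in\mathbb{Z}\}$; $f$ preserves $\mu$. The system is ergodic if every measurable invariant set $V$ (i.e. $f^{-1}(V)=V$) has $\mu(V)=0$ or $\mu(V)=1$. *)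

theory Defs
  imports "HOL-Probability.Probability"
begin

definition rat_norm2 :: "rat \<Rightarrow> real" where
  "rat_norm2 x = (if x = 0 then 0 else
     2 powi (int (multiplicity 2 (snd (quotient_of x))) - int (multiplicity 2 (fst (quotient_of x)))))"

lemma rat_norm2_div:
  fixes m n :: int
  assumes "m \<noteq> 0" "n \<noteq> 0"
  shows "rat_norm2 (of_int m / of_int n) = 2 powi (int (multiplicity 2 n) - int (multiplicity 2 m))"
proof -
  obtain k l where q: "quotient_of (of_int m / of_int n) = (k, l)" by fastforce
  have l: "l > 0" using quotient_of_denom_pos[OF q] .
  have eq: "(of_int m / of_int n :: rat) = of_int k / of_int l" using quotient_of_div[OF q] .
  have "(of_int (m * l) :: rat) = of_int (k * n)" using eq l assms by (simp add: field_simps)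
  hence ml: "m * l = k * n" by linarith
  have k: "k \<noteq> 0" using ml l assms by auto
  have p: "prime_elem (2::int)" by simp
  have "multiplicity 2 (m * l) = multiplicity 2 (k * n)" using ml by simp
  hence "multiplicity 2 m + multiplicity 2 l = multiplicity 2 k + multiplicity 2 n"
    using l k assms by (simp add: prime_elem_multiplicity_mult_distrib[OF p])
  hence "int (multiplicity 2 l) - int (multiplicity 2 k) = int (multiplicity 2 n) - int (multiplicity 2 m)"
    by linarith
  thus ?thesis using q assms by (simp add: rat_norm2_def)
qed

lemma rat_norm2_cases:
  obtains m n :: int where "(x::rat) = of_int m / of_int n" "n \<noteq> 0"
  by (metis Fract_of_int_quotient Rat_cases less_irrefl)

lemma rat_norm2_nonneg: "rat_norm2 x \<ge> 0"
  by (simp add: rat_norm2_def)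

lemma rat_norm2_0 [simp]: "rat_norm2 0 = 0"
  by (simp add: rat_norm2_def)

lemma rat_norm2_eq_0_iff [simp]: "rat_norm2 x = 0 \<longleftrightarrow> x = 0"
  by (simp add: rat_norm2_def)

lemma rat_norm2_mult: "rat_norm2 (x * y) = rat_norm2 x * rat_norm2 y"
proof (cases "x = 0 \<or> y = 0")
  case False
  obtain m n where x: "x = of_int m / of_int n" "n \<noteq> 0" by (rule rat_norm2_cases)
  obtain k l where y: "y = of_int k / of_int l" "l \<noteq> 0" by (rule rat_norm2_cases)
  have nz: "m \<noteq> 0" "k \<noteq> 0" using False x y by auto
  have xy: "x * y = of_int (m * k) / of_int (n * l)" using x y by simp
  have p: "prime_elem (2::int)" by simp
  show ?thesis
    unfolding xy using x y nz p
    by (simp add: rat_norm2_div prime_elem_multiplicity_mult_distrib algebra_simps del: of_int_mult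
        flip: power_int_add)
qed auto

lemma rat_norm2_1 [simp]: "rat_norm2 1 = 1"
  using rat_norm2_div[of 1 1] by simp

lemma rat_norm2_minus [simp]: "rat_norm2 (- x) = rat_norm2 x"
proof -
  have "multiplicity 2 (-1 :: int) = 0" by (simp add: not_dvd_imp_multiplicity_0)
  hence "rat_norm2 (-1) = 1" using rat_norm2_div[of "-1" 1] by simp
  thus ?thesis using rat_norm2_mult[of "-1" x] by simp
qed

lemma rat_norm2_minus_commute: "rat_norm2 (x - y) = rat_norm2 (y - x)"
  using rat_norm2_minus[of "x - y"] by simp

lemma rat_norm2_int_add:
  fixes m n :: int
  shows "rat_norm2 (of_int m + of_int n) \<le> max (rat_norm2 (of_int m)) (rat_norm2 (of_int n))"
proof (cases "m = 0 \<or> n = 0 \<or> m + n = 0")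
  case True
  thus ?thesis
  proof (elim disjE)
    assume "m + n = 0"
    hence "(of_int m + of_int n :: rat) = 0" by (simp flip: of_int_add)
    thus ?thesis using rat_norm2_nonneg by (simp add: le_max_iff_disj)
  qed (auto simp: rat_norm2_nonneg)
next
  case False
  define d where "d = min (multiplicity 2 m) (multiplicity 2 n)"
  have int: "rat_norm2 (of_int k) = 2 powi (- int (multiplicity 2 k))" if "k \<noteq> 0" for k :: int
    using rat_norm2_div[of k 1] that by simp
  have "2 ^ d dvd m" "2 ^ d dvd n" by (auto simp: d_def intro: multiplicity_dvd')
  hence "2 ^ d dvd m + n" by simp
  hence "d \<le> multiplicity 2 (m + n)" using False by (intro multiplicity_geI) auto
  hence "(2::real) powi (- int (multiplicity 2 (m + n))) \<le> 2 powi (- int d)"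
    by (intro power_int_increasing) auto
  also have "\<dots> \<le> max (2 powi (- int (multiplicity 2 m))) (2 powi (- int (multiplicity 2 n)))"
    by (auto simp: d_def min_def)
  finally show ?thesis using False by (simp add: int flip: of_int_add)
qed

lemma rat_norm2_add: "rat_norm2 (x + y) \<le> max (rat_norm2 x) (rat_norm2 y)"
proof -
  obtain m n where x: "x = of_int m / of_int n" "n \<noteq> 0" by (rule rat_norm2_cases)
  obtain k l where y: "y = of_int k / of_int l" "l \<noteq> 0" by (rule rat_norm2_cases)
  let ?c = "1 / of_int (n * l) :: rat"
  have "x + y = (of_int (m * l) + of_int (k * n)) * ?c"
    using x y by (simp add: add_frac_eq)
  hence "rat_norm2 (x + y) = rat_norm2 (of_int (m * l) + of_int (k * n)) * rat_norm2 ?c"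
    by (simp only: rat_norm2_mult)
  also have "\<dots> \<le> max (rat_norm2 (of_int (m * l))) (rat_norm2 (of_int (k * n))) * rat_norm2 ?c"
    by (intro mult_right_mono rat_norm2_int_add rat_norm2_nonneg)
  also have "\<dots> = max (rat_norm2 (of_int (m * l)) * rat_norm2 ?c) (rat_norm2 (of_int (k * n)) * rat_norm2 ?c)"
    by (simp add: max_mult_distrib_right rat_norm2_nonneg)
  also have "\<dots> = max (rat_norm2 x) (rat_norm2 y)"
    unfolding rat_norm2_mult[symmetric] using x(2) y(2) by (simp add: x(1) y(1))
  finally show ?thesis .
qed

lemma rat_norm2_triangle: "rat_norm2 (x + y) \<le> rat_norm2 x + rat_norm2 y"
  using rat_norm2_add[of x y] rat_norm2_nonneg[of x] rat_norm2_nonneg[of y] by linarith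

lemma rat_norm2_diff: "\<bar>rat_norm2 x - rat_norm2 y\<bar> \<le> rat_norm2 (x - y)"
  using rat_norm2_triangle[of "x - y" y] rat_norm2_triangle[of "y - x" x]
  by (simp add: rat_norm2_minus_commute[of y x])

lemma rat_norm2_inverse: "rat_norm2 (inverse x) = inverse (rat_norm2 x)"
proof (cases "x = 0")
  case False
  have "rat_norm2 (inverse x) * rat_norm2 x = 1"
    using False by (simp flip: rat_norm2_mult)
  thus ?thesis by (metis inverse_unique mult.commute)
qed auto

definition cauchy2 :: "(nat \<Rightarrow> rat) \<Rightarrow> bool" where
  "cauchy2 X \<longleftrightarrow> (\<forall>e>0. \<exists>N. \<forall>m\<ge>N. \<forall>n\<ge>N. rat_norm2 (X m - X n) < e)"

definition null2 :: "(nat \<Rightarrow> rat) \<Rightarrow> bool" where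
  "null2 X \<longleftrightarrow> (\<lambda>n. rat_norm2 (X n)) \<longlonglongrightarrow> 0"

definition q2rel :: "(nat \<Rightarrow> rat) \<Rightarrow> (nat \<Rightarrow> rat) \<Rightarrow> bool" where
  "q2rel X Y \<longleftrightarrow> cauchy2 X \<and> cauchy2 Y \<and> null2 (\<lambda>n. X n - Y n)"

lemma cauchy2_const [simp]: "cauchy2 (\<lambda>_. c)"
  by (auto simp: cauchy2_def)

lemma cauchy2_uminus: "cauchy2 X \<Longrightarrow> cauchy2 (\<lambda>n. - X n)"
  by (simp only: cauchy2_def minus_diff_minus rat_norm2_minus)

lemma cauchy2_add:
  assumes "cauchy2 X" "cauchy2 Y"
  shows "cauchy2 (\<lambda>n. X n + Y n)"
  unfolding cauchy2_def
proof (intro allI impI)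
  fix e :: real assume e: "e > 0"
  obtain M where M: "\<And>m n. m \<ge> M \<Longrightarrow> n \<ge> M \<Longrightarrow> rat_norm2 (X m - X n) < e"
    using assms(1) e unfolding cauchy2_def by blast
  obtain N where N: "\<And>m n. m \<ge> N \<Longrightarrow> n \<ge> N \<Longrightarrow> rat_norm2 (Y m - Y n) < e"
    using assms(2) e unfolding cauchy2_def by blast
  have "rat_norm2 (X m + Y m - (X n + Y n)) < e" if "m \<ge> max M N" "n \<ge> max M N" for m n
    using M[of m n] N[of m n] that rat_norm2_add[of "X m - X n" "Y m - Y n"]
    by (simp add: add_diff_add)
  thus "\<exists>N. \<forall>m\<ge>N. \<forall>n\<ge>N. rat_norm2 (X m + Y m - (X n + Y n)) < e" by blast
qed

lemma cauchy2_diff: "cauchy2 X \<Longrightarrow> cauchy2 Y \<Longrightarrow> cauchy2 (\<lambda>n. X n - Y n)"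
  using cauchy2_add[of X "\<lambda>n. - Y n"] cauchy2_uminus[of Y] by simp

lemma cauchy2_norm: "cauchy2 X \<Longrightarrow> convergent (\<lambda>n. rat_norm2 (X n))"
  unfolding Cauchy_convergent_iff[symmetric]
proof (rule metric_CauchyI)
  fix e :: real assume "cauchy2 X" "e > 0"
  thus "\<exists>M. \<forall>m\<ge>M. \<forall>n\<ge>M. dist (rat_norm2 (X m)) (rat_norm2 (X n)) < e"
    unfolding cauchy2_def dist_real_def by (meson le_less_trans rat_norm2_diff)
qed

lemma cauchy2_bounded:
  assumes "cauchy2 X"
  obtains B where "B > 0" "\<And>n. rat_norm2 (X n) \<le> B"
proof -
  have "Bseq (\<lambda>n. rat_norm2 (X n))"
    using cauchy2_norm[OF assms] by (rule convergent_imp_Bseq)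
  then obtain B where "B > 0" "\<And>n. norm (rat_norm2 (X n)) \<le> B" unfolding Bseq_def by blast
  thus ?thesis using that[of B] rat_norm2_nonneg by simp
qed

lemma null2_bound: "null2 X \<Longrightarrow> (\<And>n. rat_norm2 (Y n) \<le> C * rat_norm2 (X n)) \<Longrightarrow> null2 Y"
  unfolding null2_def
  by (rule Lim_null_comparison[of _ "\<lambda>n. C * rat_norm2 (X n)"])
     (auto simp: rat_norm2_nonneg intro: tendsto_mult_right_zero)

lemma null2_uminus: "null2 X \<Longrightarrow> null2 (\<lambda>n. - X n)"
  by (simp add: null2_def)

lemma null2_add:
  assumes "null2 X" "null2 Y"
  shows "null2 (\<lambda>n. X n + Y n)"
proof -
  have "(\<lambda>n. rat_norm2 (X n) + rat_norm2 (Y n)) \<longlonglongrightarrow> 0"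
    using tendsto_add[OF assms[unfolded null2_def]] by simp
  thus ?thesis unfolding null2_def
    by (rule Lim_null_comparison[rotated]) (auto simp: rat_norm2_nonneg rat_norm2_triangle)
qed

lemma cauchy2_mult:
  assumes "cauchy2 X" "cauchy2 Y"
  shows "cauchy2 (\<lambda>n. X n * Y n)"
  unfolding cauchy2_def
proof (intro allI impI)
  fix e :: real assume e: "e > 0"
  obtain A where A: "A > 0" "\<And>n. rat_norm2 (X n) \<le> A" using cauchy2_bounded[OF assms(1)] by blast
  obtain B where B: "B > 0" "\<And>n. rat_norm2 (Y n) \<le> B" using cauchy2_bounded[OF assms(2)] by blast
  have eA: "e / A > 0" and eB: "e / B > 0" using A B e by auto
  obtain M where M: "\<And>m n. m \<ge> M \<Longrightarrow> n \<ge> M \<Longrightarrow> rat_norm2 (X m - X n) < e / B"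
    using assms(1) eB unfolding cauchy2_def by blast
  obtain N where N: "\<And>m n. m \<ge> N \<Longrightarrow> n \<ge> N \<Longrightarrow> rat_norm2 (Y m - Y n) < e / A"
    using assms(2) eA unfolding cauchy2_def by blast
  have "rat_norm2 (X m * Y m - X n * Y n) < e" if mn: "m \<ge> max M N" "n \<ge> max M N" for m n
  proof -
    have "rat_norm2 (X m * (Y m - Y n)) \<le> A * rat_norm2 (Y m - Y n)"
      unfolding rat_norm2_mult by (intro mult_right_mono A rat_norm2_nonneg)
    also have "\<dots> < e" using N[of m n] mn A by (simp add: field_simps)
    finally have 1: "rat_norm2 (X m * (Y m - Y n)) < e" .
    have "rat_norm2 ((X m - X n) * Y n) \<le> rat_norm2 (X m - X n) * B"
      unfolding rat_norm2_mult by (intro mult_left_mono B rat_norm2_nonneg)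
    also have "\<dots> < e" using M[of m n] mn B by (simp add: field_simps)
    finally have 2: "rat_norm2 ((X m - X n) * Y n) < e" .
    have "X m * Y m - X n * Y n = X m * (Y m - Y n) + (X m - X n) * Y n"
      by (simp add: algebra_simps)
    thus ?thesis using 1 2 rat_norm2_add[of "X m * (Y m - Y n)" "(X m - X n) * Y n"] by simp
  qed
  thus "\<exists>N. \<forall>m\<ge>N. \<forall>n\<ge>N. rat_norm2 (X m * Y m - X n * Y n) < e" by blast
qed

lemma null2_mult_left:
  assumes "cauchy2 X" "null2 Y"
  shows "null2 (\<lambda>n. X n * Y n)"
proof -
  obtain A where A: "A > 0" "\<And>n. rat_norm2 (X n) \<le> A" using cauchy2_bounded[OF assms(1)] by blast
  have "rat_norm2 (X n * Y n) \<le> A * rat_norm2 (Y n)" for n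
    unfolding rat_norm2_mult by (rule mult_right_mono[OF A(2) rat_norm2_nonneg])
  thus ?thesis by (rule null2_bound[OF assms(2)])
qed

lemma cauchy2_not_null:
  assumes "cauchy2 X" "\<not> null2 X"
  obtains d N where "d > 0" "\<And>n. n \<ge> N \<Longrightarrow> rat_norm2 (X n) > d"
proof -
  obtain L where L: "(\<lambda>n. rat_norm2 (X n)) \<longlonglongrightarrow> L"
    using cauchy2_norm[OF assms(1)] unfolding convergent_def by blast
  have "L \<ge> 0" using L by (rule LIMSEQ_le_const) (auto simp: rat_norm2_nonneg)
  moreover have "L \<noteq> 0" using L assms(2) unfolding null2_def by auto
  ultimately have "L / 2 > 0" "L / 2 < L" by auto
  moreover from order_tendstoD(1)[OF L this(2)]
  obtain N where "\<And>n. n \<ge> N \<Longrightarrow> rat_norm2 (X n) > L / 2"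
    unfolding eventually_sequentially by blast
  ultimately show ?thesis using that by blast
qed

lemma cauchy2_inverse:
  assumes "cauchy2 X" "\<not> null2 X"
  shows "cauchy2 (\<lambda>n. inverse (X n))"
  unfolding cauchy2_def
proof (intro allI impI)
  fix e :: real assume e: "e > 0"
  obtain d N where d: "d > 0" "\<And>n. n \<ge> N \<Longrightarrow> rat_norm2 (X n) > d" using cauchy2_not_null[OF assms] by blast
  have "e * (d * d) > 0" using e d by simp
  then obtain M where M: "\<And>m n. m \<ge> M \<Longrightarrow> n \<ge> M \<Longrightarrow> rat_norm2 (X m - X n) < e * (d * d)"
    using assms(1) unfolding cauchy2_def by blast
  have "rat_norm2 (inverse (X m) - inverse (X n)) < e" if mn: "m \<ge> max M N" "n \<ge> max M N" for m n
  proof -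
    have gt: "rat_norm2 (X m) > d" "rat_norm2 (X n) > d" using d mn by auto
    hence nz: "X m \<noteq> 0" "X n \<noteq> 0" using d(1) by auto
    have "rat_norm2 (X n - X m) < e * (d * d)" using M[of n m] mn by simp
    also have "\<dots> \<le> e * (rat_norm2 (X m) * rat_norm2 (X n))"
      using gt d(1) e by (intro mult_left_mono mult_mono) auto
    finally have lt: "rat_norm2 (X n - X m) < e * (rat_norm2 (X m) * rat_norm2 (X n))" .
    have "inverse (X m) - inverse (X n) = (X n - X m) * inverse (X m) * inverse (X n)"
      using nz by (simp add: field_simps)
    hence "rat_norm2 (inverse (X m) - inverse (X n))
        = rat_norm2 (X n - X m) / (rat_norm2 (X m) * rat_norm2 (X n))"
      by (simp add: rat_norm2_mult rat_norm2_inverse divide_inverse)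
    thus ?thesis using lt gt d(1) by (simp add: pos_divide_less_eq)
  qed
  thus "\<exists>N. \<forall>m\<ge>N. \<forall>n\<ge>N. rat_norm2 (inverse (X m) - inverse (X n)) < e" by blast
qed

lemma q2rel_sym: "q2rel X Y \<Longrightarrow> q2rel Y X"
  unfolding q2rel_def null2_def by (simp add: rat_norm2_minus_commute)

lemma q2rel_trans: "q2rel X Y \<Longrightarrow> q2rel Y Z \<Longrightarrow> q2rel X Z"
  unfolding q2rel_def using null2_add[of "\<lambda>n. X n - Y n" "\<lambda>n. Y n - Z n"] by simp

lemma q2rel_null: "q2rel X Y \<Longrightarrow> null2 X \<longleftrightarrow> null2 Y"
  using null2_add[of "\<lambda>n. X n - Y n" Y] null2_add[of "\<lambda>n. Y n - X n" X] q2rel_sym[of X Y]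
  unfolding q2rel_def by auto

text \<open>The field of 2-adic numbers: equivalence classes of rational Cauchy sequences (for the 2-adic
  absolute value) modulo null sequences.\<close>

quotient_type q2 = "nat \<Rightarrow> rat" / partial: q2rel
  morphisms rep_q2 abs_q2
proof (rule part_equivpI)
  show "\<exists>X. q2rel X X" by (rule exI[of _ "\<lambda>_. 0"]) (simp add: q2rel_def null2_def)
  show "symp q2rel" by (rule sympI) (rule q2rel_sym)
  show "transp q2rel" by (rule transpI) (rule q2rel_trans)
qed

instantiation q2 :: field
begin

lift_definition zero_q2 :: q2 is "\<lambda>_. 0"
  by (simp add: q2rel_def null2_def)

lift_definition one_q2 :: q2 is "\<lambda>_. 1"
  by (simp add: q2rel_def null2_def)

lift_definition plus_q2 :: "q2 \<Rightarrow> q2 \<Rightarrow> q2" is "\<lambda>X Y n. X n + Y n"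
  unfolding q2rel_def add_diff_add by (auto intro!: cauchy2_add null2_add)

lift_definition uminus_q2 :: "q2 \<Rightarrow> q2" is "\<lambda>X n. - X n"
  unfolding q2rel_def minus_diff_minus by (simp only: cauchy2_uminus null2_uminus)

lift_definition times_q2 :: "q2 \<Rightarrow> q2 \<Rightarrow> q2" is "\<lambda>X Y n. X n * Y n"
proof -
  fix X X' Y Y' assume a: "q2rel X X'" "q2rel Y Y'"
  have "null2 (\<lambda>n. X n * (Y n - Y' n) + Y' n * (X n - X' n))"
    using a unfolding q2rel_def by (intro null2_add null2_mult_left) auto
  thus "q2rel (\<lambda>n. X n * Y n) (\<lambda>n. X' n * Y' n)"
    using a unfolding q2rel_def by (auto simp: algebra_simps intro: cauchy2_mult)
qed

lift_definition inverse_q2 :: "q2 \<Rightarrow> q2"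
  is "\<lambda>X. if null2 X then (\<lambda>_. 0) else (\<lambda>n. inverse (X n))"
proof -
  fix X Y assume a: "q2rel X Y"
  have XY: "cauchy2 X" "cauchy2 Y" "null2 (\<lambda>n. X n - Y n)" using a by (auto simp: q2rel_def)
  show "q2rel (if null2 X then (\<lambda>_. 0) else (\<lambda>n. inverse (X n)))
              (if null2 Y then (\<lambda>_. 0) else (\<lambda>n. inverse (Y n)))"
  proof (cases "null2 X")
    case True
    thus ?thesis using q2rel_null[OF a] by (simp add: q2rel_def null2_def)
  next
    case False
    hence nY: "\<not> null2 Y" using q2rel_null[OF a] by simp
    have iX: "cauchy2 (\<lambda>n. inverse (X n))" and iY: "cauchy2 (\<lambda>n. inverse (Y n))"
      using cauchy2_inverse XY False nY by auto
    obtain d N where d: "d > 0" "\<And>n. n \<ge> N \<Longrightarrow> rat_norm2 (X n) > d"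
      using cauchy2_not_null[OF XY(1) False] by blast
    obtain d' N' where d': "d' > 0" "\<And>n. n \<ge> N' \<Longrightarrow> rat_norm2 (Y n) > d'"
      using cauchy2_not_null[OF XY(2) nY] by blast
    have null: "null2 (\<lambda>n. (- inverse (X n) * inverse (Y n)) * (X n - Y n))"
      using XY(3) iX iY by (intro null2_mult_left cauchy2_mult cauchy2_uminus)
    have "eventually (\<lambda>n. (- inverse (X n) * inverse (Y n)) * (X n - Y n)
                          = inverse (X n) - inverse (Y n)) sequentially"
      using eventually_ge_at_top[of N] eventually_ge_at_top[of N']
    proof eventually_elim
      case (elim n)
      hence "X n \<noteq> 0" "Y n \<noteq> 0"
        using d(1) d(2)[of n] d'(1) d'(2)[of n] by auto
      thus ?case by (simp add: field_simps)
    qed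
    hence "null2 (\<lambda>n. inverse (X n) - inverse (Y n))"
      unfolding null2_def
      by (rule Lim_transform_eventually[OF null[unfolded null2_def] eventually_mono]) simp
    thus ?thesis using False nY iX iY by (simp add: q2rel_def)
  qed
qed

definition minus_q2 :: "q2 \<Rightarrow> q2 \<Rightarrow> q2" where "minus_q2 x y = x + - y"

definition divide_q2 :: "q2 \<Rightarrow> q2 \<Rightarrow> q2" where "divide_q2 x y = x * inverse y"

lemma q2_refl: "cauchy2 X \<Longrightarrow> q2rel X X"
  by (simp add: q2rel_def null2_def)

lemma q2relD: "q2rel X Y \<Longrightarrow> cauchy2 X"
  by (simp add: q2rel_def)

instance
proof
  fix x y z :: q2
  show "x + y + z = x + (y + z)"
    by transfer (auto simp: add.assoc dest!: q2relD intro!: q2_refl cauchy2_add)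
  show "x + y = y + x"
    by transfer (auto simp: add.commute dest!: q2relD intro!: q2_refl cauchy2_add)
  show "0 + x = x" by transfer simp
  show "- x + x = 0" by transfer (simp add: q2_refl)
  show "x - y = x + - y" by (simp add: minus_q2_def)
  show "x * y * z = x * (y * z)"
    by transfer (auto simp: mult.assoc dest!: q2relD intro!: q2_refl cauchy2_mult)
  show "x * y = y * x"
    by transfer (auto simp: mult.commute dest!: q2relD intro!: q2_refl cauchy2_mult)
  show "1 * x = x" by transfer simp
  show "(x + y) * z = x * z + y * z"
    by transfer (auto simp: ring_distribs dest!: q2relD intro!: q2_refl cauchy2_mult cauchy2_add)
  show "(0::q2) \<noteq> 1" by transfer (simp add: q2rel_def null2_def LIMSEQ_const_iff)
  show "x div y = x * inverse y" by (simp add: divide_q2_def)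
  show "inverse (0::q2) = 0" by transfer (simp add: q2rel_def null2_def)
  show "inverse x * x = 1" if "x \<noteq> 0"
    using that
  proof transfer
    fix X assume X: "q2rel X X" and nz: "\<not> q2rel X (\<lambda>_. 0)"
    have c: "cauchy2 X" and nn: "\<not> null2 X" using X nz by (auto simp: q2rel_def)
    obtain d N where d: "d > 0" "\<And>n. n \<ge> N \<Longrightarrow> rat_norm2 (X n) > d"
      using cauchy2_not_null[OF c nn] by blast
    have "eventually (\<lambda>n. rat_norm2 (inverse (X n) * X n - 1) = 0) sequentially"
      using eventually_ge_at_top[of N]
    proof eventually_elim
      case (elim n)
      hence "X n \<noteq> 0" using d(1) d(2)[of n] by auto
      thus ?case by simp
    qed
    hence "null2 (\<lambda>n. inverse (X n) * X n - 1)"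
      unfolding null2_def by (rule tendsto_eventually)
    thus "q2rel (\<lambda>n. (if null2 X then \<lambda>_. 0 else (\<lambda>n. inverse (X n))) n * X n) (\<lambda>_. 1)"
      using nn c cauchy2_inverse[OF c nn] by (simp add: q2rel_def cauchy2_mult)
  qed
qed

end

text \<open>The 2-adic absolute value on the completion. No instance of \<open>real_normed_vector\<close> is possible,
  hence a constant of its own.\<close>

lift_definition norm2 :: "q2 \<Rightarrow> real" is "\<lambda>X. lim (\<lambda>n. rat_norm2 (X n))"
proof -
  fix X Y assume a: "q2rel X Y"
  have X: "(\<lambda>n. rat_norm2 (X n)) \<longlonglongrightarrow> lim (\<lambda>n. rat_norm2 (X n))"
    using a cauchy2_norm unfolding q2rel_def convergent_LIMSEQ_iff by blast
  have "(\<lambda>n. rat_norm2 (Y n) - rat_norm2 (X n)) \<longlonglongrightarrow> 0"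
  proof (rule Lim_null_comparison)
    show "(\<lambda>n. rat_norm2 (X n - Y n)) \<longlonglongrightarrow> 0" using a by (simp add: q2rel_def null2_def)
    show "eventually (\<lambda>n. norm (rat_norm2 (Y n) - rat_norm2 (X n)) \<le> rat_norm2 (X n - Y n)) sequentially"
      using rat_norm2_diff by (simp add: abs_minus_commute)
  qed
  from tendsto_add[OF this X] show "lim (\<lambda>n. rat_norm2 (X n)) = lim (\<lambda>n. rat_norm2 (Y n))"
    by (simp add: limI)
qed

lemma cauchy2_lim: "cauchy2 X \<Longrightarrow> (\<lambda>n. rat_norm2 (X n)) \<longlonglongrightarrow> lim (\<lambda>n. rat_norm2 (X n))"
  using cauchy2_norm convergent_LIMSEQ_iff by blast

lemma norm2_nonneg: "norm2 x \<ge> 0"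
proof transfer
  fix X assume "q2rel X X"
  thus "lim (\<lambda>n. rat_norm2 (X n)) \<ge> 0"
    by (intro LIMSEQ_le_const[OF cauchy2_lim]) (auto dest: q2relD simp: rat_norm2_nonneg)
qed

lemma norm2_eq_0_iff [simp]: "norm2 x = 0 \<longleftrightarrow> x = 0"
proof transfer
  fix X assume "q2rel X X"
  hence c: "cauchy2 X" by (rule q2relD)
  show "lim (\<lambda>n. rat_norm2 (X n)) = 0 \<longleftrightarrow> q2rel X (\<lambda>_. 0)"
    using cauchy2_lim[OF c] c by (auto simp: q2rel_def null2_def dest: limI)
qed

lemma norm2_mult: "norm2 (x * y) = norm2 x * norm2 y"
proof transfer
  fix X Y assume "q2rel X X" "q2rel Y Y"
  thus "lim (\<lambda>n. rat_norm2 (X n * Y n)) = lim (\<lambda>n. rat_norm2 (X n)) * lim (\<lambda>n. rat_norm2 (Y n))"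
    unfolding rat_norm2_mult by (intro limI tendsto_mult cauchy2_lim q2relD)
qed

lemma norm2_minus [simp]: "norm2 (- x) = norm2 x"
  by transfer simp

lemma norm2_minus_commute: "norm2 (x - y) = norm2 (y - x)"
  using norm2_minus[of "x - y"] by simp

lemma norm2_ultrametric: "norm2 (x + y) \<le> max (norm2 x) (norm2 y)"
proof transfer
  fix X Y assume "q2rel X X" "q2rel Y Y"
  hence c: "cauchy2 X" "cauchy2 Y" by (auto dest: q2relD)
  show "lim (\<lambda>n. rat_norm2 (X n + Y n)) \<le> max (lim (\<lambda>n. rat_norm2 (X n))) (lim (\<lambda>n. rat_norm2 (Y n)))"
    by (rule LIMSEQ_le[OF cauchy2_lim[OF cauchy2_add[OF c]]
          tendsto_max[OF cauchy2_lim[OF c(1)] cauchy2_lim[OF c(2)]]])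
       (auto simp: rat_norm2_add)
qed

lemma of_nat_q2: "of_nat k = abs_q2 (\<lambda>_. of_nat k)"
proof (induction k)
  case 0
  show ?case by (simp add: zero_q2_def)
next
  case (Suc k)
  show ?case
    by (simp add: Suc one_q2_def plus_q2.abs_eq q2_refl)
qed

instance q2 :: field_char_0
proof
  show "inj (of_nat :: nat \<Rightarrow> q2)"
  proof (rule injI)
    fix k l :: nat assume "(of_nat k :: q2) = of_nat l"
    hence "q2rel (\<lambda>_. of_nat k) (\<lambda>_. of_nat l)"
      unfolding of_nat_q2 using Quotient3_rel[OF Quotient3_q2] q2_refl cauchy2_const by blast
    thus "k = l" by (simp add: q2rel_def null2_def LIMSEQ_const_iff)
  qed
qed

lemma of_int_q2: "of_int k = abs_q2 (\<lambda>_. of_int k)"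
  by (cases k rule: int_cases2)
     (simp_all add: of_nat_q2 uminus_q2.abs_eq q2_refl)

lemma of_rat_q2: "of_rat r = abs_q2 (\<lambda>_. r)"
proof -
  obtain m n where r: "r = of_int m / of_int n" "n \<noteq> 0" by (rule rat_norm2_cases)
  have "abs_q2 (\<lambda>_. r) * of_int n = of_int m"
    using r by (simp add: of_int_q2 times_q2.abs_eq q2_refl)
  hence "abs_q2 (\<lambda>_. r) = of_int m / of_int n" using r(2) by (simp add: nonzero_eq_divide_eq)
  thus ?thesis by (simp add: r(1) of_rat_divide)
qed

lemma norm2_of_rat: "norm2 (of_rat r) = rat_norm2 r"
  by (simp add: of_rat_q2 norm2.abs_eq q2_refl limI)

lemma norm2_2: "norm2 2 = 1 / 2"
proof -
  have "multiplicity 2 (2 :: int) = 1" by (simp add: multiplicity_self)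
  hence "rat_norm2 2 = 1 / 2" using rat_norm2_div[of 2 1] by simp
  thus ?thesis using norm2_of_rat[of 2] by simp
qed

instantiation q2 :: metric_space
begin

definition dist_q2 :: "q2 \<Rightarrow> q2 \<Rightarrow> real" where "dist_q2 x y = norm2 (x - y)"

definition uniformity_q2 :: "(q2 \<times> q2) filter" where
  "uniformity_q2 = (INF e\<in>{0 <..}. principal {(x, y). dist x y < e})"

definition open_q2 :: "q2 set \<Rightarrow> bool" where
  "open_q2 U = (\<forall>x\<in>U. eventually (\<lambda>(x', y). x' = x \<longrightarrow> y \<in> U) uniformity)"

instance
proof
  fix x y z :: q2
  show "dist x y = 0 \<longleftrightarrow> x = y" by (simp add: dist_q2_def)
  have "norm2 (x - y) \<le> max (norm2 (x - z)) (norm2 (z - y))"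
    using norm2_ultrametric[of "x - z" "z - y"] by simp
  thus "dist x y \<le> dist x z + dist y z"
    using norm2_nonneg[of "x - z"] norm2_nonneg[of "z - y"]
    by (auto simp: dist_q2_def norm2_minus_commute[of y z])
qed (simp_all only: uniformity_q2_def open_q2_def)

end

lemma of_rat_dense_q2:
  fixes x :: q2
  assumes "e > 0"
  obtains r where "dist x (of_rat r) < e"
proof -
  obtain X where X: "x = abs_q2 X" "cauchy2 X"
    using that[of "rep_q2 x"] Quotient3_abs_rep[OF Quotient3_q2, of x]
      q2relD[OF Quotient3_rep_reflp[OF Quotient3_q2, of x]] by simp
  obtain N where N: "\<And>m n. m \<ge> N \<Longrightarrow> n \<ge> N \<Longrightarrow> rat_norm2 (X m - X n) < e / 2"
    using X(2) assms unfolding cauchy2_def by (meson half_gt_zero)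
  have c: "cauchy2 (\<lambda>n. X n - X N)" using X(2) by (intro cauchy2_diff) auto
  have "x - of_rat (X N) = abs_q2 (\<lambda>n. X n - X N)"
    using X by (simp add: of_rat_q2 minus_q2_def uminus_q2.abs_eq plus_q2.abs_eq q2_refl cauchy2_uminus)
  hence "norm2 (x - of_rat (X N)) = lim (\<lambda>n. rat_norm2 (X n - X N))"
    using c by (simp add: norm2.abs_eq q2_refl)
  also have "\<dots> \<le> e / 2"
    by (rule LIMSEQ_le_const2[OF cauchy2_lim[OF c]]) (use N in \<open>auto intro!: exI[of _ N] less_imp_le\<close>)
  also have "\<dots> < e" using assms by simp
  finally show ?thesis using that by (auto simp: dist_q2_def)
qed

instance q2 :: complete_space
proof
  fix X :: "nat \<Rightarrow> q2" assume X: "Cauchy X"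
  have "\<exists>r. dist (X n) (of_rat r) < inverse (real (Suc n))" for n
    by (rule of_rat_dense_q2[of "inverse (real (Suc n))" "X n"]) auto
  then obtain R where R: "\<And>n. dist (X n) (of_rat (R n)) < inverse (real (Suc n))" by metis
  have lim0: "(\<lambda>n. dist (X n) (of_rat (R n))) \<longlonglongrightarrow> 0"
    by (rule Lim_null_comparison[OF _ LIMSEQ_inverse_real_of_nat])
       (use R in \<open>auto intro!: always_eventually less_imp_le\<close>)
  have CR: "Cauchy (\<lambda>n. of_rat (R n) :: q2)"
  proof (rule metric_CauchyI)
    fix e :: real assume e: "e > 0"
    obtain M where M: "\<And>m n. m \<ge> M \<Longrightarrow> n \<ge> M \<Longrightarrow> dist (X m) (X n) < e / 3"
      using metric_CauchyD[OF X, of "e / 3"] e by auto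
    obtain N where N: "\<And>n. n \<ge> N \<Longrightarrow> dist (X n) (of_rat (R n)) < e / 3"
      using order_tendstoD(2)[OF lim0, of "e / 3"] e by (auto simp: eventually_sequentially)
    have "dist (of_rat (R m)) (of_rat (R n) :: q2) < e" if "m \<ge> max M N" "n \<ge> max M N" for m n
      using M[of m n] N[of m] N[of n] that
        dist_triangle[of "of_rat (R m)" "of_rat (R n)" "X m"]
        dist_triangle[of "X m" "of_rat (R n)" "X n"] dist_commute[of "of_rat (R m)" "X m"]
      by auto
    thus "\<exists>M. \<forall>m\<ge>M. \<forall>n\<ge>M. dist (of_rat (R m)) (of_rat (R n) :: q2) < e" by blast
  qed
  have dR: "dist (of_rat p) (of_rat q :: q2) = rat_norm2 (p - q)" for p q
    by (simp add: dist_q2_def norm2_of_rat flip: of_rat_diff)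
  have c: "cauchy2 R" using CR by (simp add: Cauchy_def cauchy2_def dR)
  define L where "L = abs_q2 R"
  have "(\<lambda>n. of_rat (R n)) \<longlonglongrightarrow> L"
  proof (rule metric_LIMSEQ_I)
    fix e :: real assume e: "e > 0"
    obtain N where N: "\<And>m n. m \<ge> N \<Longrightarrow> n \<ge> N \<Longrightarrow> rat_norm2 (R m - R n) < e / 2"
      using c e unfolding cauchy2_def by (meson half_gt_zero)
    have "dist (of_rat (R n)) L < e" if n: "n \<ge> N" for n
    proof -
      have cn: "cauchy2 (\<lambda>k. R n - R k)" using c by (intro cauchy2_diff) auto
      have "of_rat (R n) - L = abs_q2 (\<lambda>k. R n - R k)"
        using c by (simp add: L_def of_rat_q2 minus_q2_def uminus_q2.abs_eq plus_q2.abs_eq q2_refl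
            cauchy2_uminus)
      hence "norm2 (of_rat (R n) - L) = lim (\<lambda>k. rat_norm2 (R n - R k))"
        using cn by (simp add: norm2.abs_eq q2_refl)
      also have "\<dots> \<le> e / 2"
        by (rule LIMSEQ_le_const2[OF cauchy2_lim[OF cn]])
           (use N n in \<open>auto intro!: exI[of _ N] less_imp_le\<close>)
      finally show ?thesis using e by (simp add: dist_q2_def)
    qed
    thus "\<exists>no. \<forall>n\<ge>no. dist (of_rat (R n)) L < e" by blast
  qed
  hence "(\<lambda>n. dist (of_rat (R n)) L) \<longlonglongrightarrow> 0" by (rule iffD1[OF tendsto_dist_iff])
  from tendsto_add[OF lim0 this] have "(\<lambda>n. dist (X n) (of_rat (R n)) + dist (of_rat (R n)) L) \<longlonglongrightarrow> 0"
    by simp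
  hence "(\<lambda>n. dist (X n) L) \<longlonglongrightarrow> 0"
    by (rule Lim_null_comparison[rotated]) (auto simp: dist_triangle)
  hence "X \<longlonglongrightarrow> L" by (rule iffD2[OF tendsto_dist_iff])
  thus "convergent X" by (auto simp: convergent_def)
qed

text \<open>The library's \<open>sphere\<close> and \<open>cball\<close> for the metric above are the sets
  \<open>S_r(c)\<close> and \<open>V_r(c)\<close>.\<close>

lemma sphere_q2: "sphere (0::q2) r = {x. norm2 x = r}"
  by (auto simp: dist_q2_def)

lemma cball_q2: "cball (c::q2) r = {x. norm2 (x - c) \<le> r}"
  by (auto simp: dist_q2_def norm2_minus_commute)

text \<open>The map is only meaningful away from its pole \<open>- b / a\<close>, where division by zero yields the
  junk value 0. If \<open>4 * \<alpha> \<le> \<beta>\<close> for the absolute values \<open>\<alpha>\<close>, \<open>\<beta>\<close> of the roots of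
  \<open>x\<^sup>2 + a * x + b\<close>, the pole has absolute value \<open>\<alpha> < \<beta> / 2\<close>, so it does not lie on the
  sphere of radius \<open>\<beta> / 2\<close>.\<close>

definition ratfun :: "q2 \<Rightarrow> q2 \<Rightarrow> q2 \<Rightarrow> q2" where
  "ratfun a b x = (x ^ 3 + a * x\<^sup>2 + b * x) / (a * x + b)"

text \<open>The normalized Haar measure on the Borel sets of \<open>S_r(0)\<close>, characterized by its values on
  the balls contained in that sphere. (The radius \<open>r * (1 - 1 / 2)\<close> is that of the largest such
  ball, which is the whole sphere.)\<close>

definition normalized_haar_sphere :: "real \<Rightarrow> q2 measure \<Rightarrow> bool" where
  "normalized_haar_sphere r \<mu> \<longleftrightarrow>
     sets \<mu> = sets (restrict_space borel (sphere 0 r)) \<and> prob_space \<mu> \<and>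
     (\<forall>c. \<forall>n::int. cball c (2 powi n) \<subseteq> sphere 0 r \<longrightarrow>
        measure \<mu> (cball c (2 powi n)) = 2 powi n / (r * (1 - 1 / 2)))"

text \<open>Ergodicity of the system formed by the space of \<open>\<mu>\<close>, a self-map \<open>f\<close> of it, and
  \<open>\<mu>\<close>; the preimage is taken within that space.\<close>

definition ergodic :: "'a measure \<Rightarrow> ('a \<Rightarrow> 'a) \<Rightarrow> bool" where
  "ergodic \<mu> f \<longleftrightarrow>
     (\<forall>V \<in> sets \<mu>. f -` V \<inter> space \<mu> = V \<longrightarrow> measure \<mu> V = 0 \<or> measure \<mu> V = 1)"

end

theory Submission
  imports Defs
begin

text \<open>
  Put \<open>r = \<beta> / 2\<close> and write \<open>f(x) = x + h(x)\<close> with \<open>h(x) = x\<^sup>3 / (a x + b)\<close>. On \<open>S\<^sub>r(0)\<close> we have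
  \<open>|h(x)| = r / 2\<close> and \<open>|h(x) - h(y)| \<le> |x - y| / 4\<close>. The second bound makes \<open>f\<close> an isometry, passes to
  all iterates, and gives \<open>f\<^sup>2\<^sup>m(x) - x \<approx> 2 (f\<^sup>m(x) - x)\<close>, so that \<open>f\<close> iterated \<open>2\<^sup>n\<close> times moves every
  point by exactly \<open>r / 2\<^sup>n\<^sup>+\<^sup>1\<close>. Hence every orbit meets every ball of radius \<open>r / 2\<^sup>n\<^sup>+\<^sup>1\<close>. The measure of
  the intersection of an invariant set \<open>V\<close> with such a ball therefore does not depend on the ball, so
  \<open>\<mu>(V \<inter> B) = \<mu>(V) \<mu>(B)\<close> for balls \<open>B\<close>, then for all Borel sets \<open>B\<close>, and \<open>B = V\<close> gives
  \<open>\<mu>(V) = \<mu>(V)\<^sup>2\<close>.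
\<close>

section \<open>The dyadic absolute value\<close>

lemma norm2_0 [simp]: "norm2 0 = 0"
  by simp

lemma norm2_1 [simp]: "norm2 1 = 1"
  using norm2_of_rat[of 1] by simp

lemma norm2_divide: "norm2 (x / y) = norm2 x / norm2 y"
proof (cases "y = 0")
  case False
  then have "norm2 (x / y) * norm2 y = norm2 x"
    by (simp flip: norm2_mult)
  with False show ?thesis
    by (simp add: eq_divide_eq)
qed simp

lemma norm2_diff_ultrametric: "norm2 (x - y) \<le> max (norm2 x) (norm2 y)"
  using norm2_ultrametric[of x "- y"] by simp

lemma norm2_add_eq_right:
  assumes "norm2 x < norm2 y"
  shows "norm2 (x + y) = norm2 y"
  using norm2_ultrametric[of x y] norm2_diff_ultrametric[of "x + y" x] assms by simp

text \<open>Rationals are dense, and an error smaller than the absolute value of \<open>x\<close>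
  cannot change that absolute value. This transfers the value group and the residue field from
  \<open>rat_norm2\<close> to \<open>norm2\<close>.\<close>

lemma norm2_of_rat_approx:
  assumes "x \<noteq> 0"
  obtains q where "norm2 (x - of_rat q) < norm2 x" "norm2 x = rat_norm2 q"
proof -
  have "norm2 x > 0"
    using assms norm2_nonneg[of x] by (simp add: less_le)
  then obtain q where q: "norm2 (x - of_rat q) < norm2 x"
    using of_rat_dense_q2 by (metis dist_q2_def)
  then have "norm2 (of_rat q) = norm2 x"
    using norm2_add_eq_right[of "of_rat q - x" x] by (simp add: norm2_minus_commute)
  then show ?thesis
    by (intro that[OF q]) (simp add: norm2_of_rat)
qed

lemma rat_norm2_powi:
  assumes "q \<noteq> 0"
  obtains n :: int where "rat_norm2 q = 2 powi n"
proof (rule that)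
  show "rat_norm2 q =
      2 powi (int (multiplicity 2 (snd (quotient_of q))) - int (multiplicity 2 (fst (quotient_of q))))"
    using assms by (simp add: rat_norm2_def)
qed

lemma norm2_powi:
  assumes "x \<noteq> 0"
  obtains n :: int where "norm2 x = 2 powi n"
proof -
  obtain q where q: "norm2 x = rat_norm2 q"
    using norm2_of_rat_approx[OF assms] by blast
  with assms have "q \<noteq> 0"
    by (metis norm2_eq_0_iff rat_norm2_0)
  with q that show ?thesis
    by (metis rat_norm2_powi)
qed

text \<open>The nonzero absolute values are powers of 2, so a strict inequality gains a factor
  2.\<close>

lemma norm2_le_half:
  assumes "norm2 x < norm2 y"
  shows "norm2 x \<le> norm2 y / 2"
proof (cases "x = 0")
  case False
  have "y \<noteq> 0"
    using assms norm2_nonneg[of x] by auto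
  obtain m where m: "norm2 x = 2 powi m"
    using norm2_powi[OF False] .
  obtain n where n: "norm2 y = 2 powi n"
    using norm2_powi[OF \<open>y \<noteq> 0\<close>] .
  have "m < n"
  proof (rule ccontr)
    assume "\<not> m < n"
    then have "(2::real) powi n \<le> 2 powi m"
      by (intro power_int_increasing) auto
    with assms m n show False
      by simp
  qed
  then have "(2::real) powi m \<le> 2 powi (n - 1)"
    by (intro power_int_increasing) auto
  then show ?thesis
    by (simp add: m n power_int_diff)
qed (simp add: norm2_nonneg)

text \<open>The residue field has two elements, so the difference of two units is even.\<close>

lemma rat_norm2_diff_1:
  assumes "rat_norm2 q = 1"
  shows "rat_norm2 (q - 1) < 1"
proof (cases "q = 1")
  case False
  obtain m n where mn: "quotient_of q = (m, n)"
    by fastforce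
  have q: "q = of_int m / of_int n" and n: "n > 0" and "coprime m n"
    using quotient_of_div[OF mn] quotient_of_denom_pos[OF mn] quotient_of_coprime[OF mn] by auto
  have "m \<noteq> 0"
    using assms q by auto
  have "2 powi (int (multiplicity 2 n) - int (multiplicity 2 m)) = (1::real)"
    using assms rat_norm2_div[of m n] \<open>m \<noteq> 0\<close> n q by simp
  then have "multiplicity 2 m = multiplicity 2 n"
    using power_int_strict_increasing[of "int (multiplicity 2 n) - int (multiplicity 2 m)" 0 "2::real"]
      power_int_strict_increasing[of 0 "int (multiplicity 2 n) - int (multiplicity 2 m)" "2::real"]
    by (cases "multiplicity 2 m" "multiplicity 2 n" rule: linorder_cases) simp_all
  \<comment> \<open>Coprimality excludes a common factor 2, so the equal multiplicities of
    \<open>m\<close> and \<open>n\<close> are both 0.\<close>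
  moreover have "\<not> (even m \<and> even n)"
    using \<open>coprime m n\<close> by (auto simp: coprime_def dest: spec[of _ 2])
  ultimately have odd: "odd m" "odd n"
    using \<open>m \<noteq> 0\<close> n multiplicity_eq_zero_iff[of m 2] multiplicity_eq_zero_iff[of n 2] by auto
  have "m - n \<noteq> 0"
    using False q n by auto
  have "q - 1 = of_int (m - n) / of_int n"
    using q n by (simp add: field_simps)
  then have "rat_norm2 (q - 1) = 2 powi (int (multiplicity 2 n) - int (multiplicity 2 (m - n)))"
    using rat_norm2_div[of "m - n" n] \<open>m - n \<noteq> 0\<close> n by simp
  moreover have "multiplicity 2 n = 0"
    using odd by (simp add: not_dvd_imp_multiplicity_0)
  moreover have "multiplicity 2 (m - n) > 0"
    using odd \<open>m - n \<noteq> 0\<close> by (simp add: multiplicity_gt_zero_iff)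
  ultimately show ?thesis
    using power_int_strict_increasing[of "- int (multiplicity 2 (m - n))" 0 "2::real"] by simp
qed simp

text \<open>Division by \<open>y\<close> reduces this to the unit \<open>x / y\<close>; a rational
  unit \<open>q\<close> at distance less than 1 from it is congruent to 1 by
  \<open>rat_norm2_diff_1\<close>.\<close>

lemma norm2_diff_less:
  assumes "norm2 x = norm2 y" "y \<noteq> 0"
  shows "norm2 (x - y) < norm2 y"
proof -
  have y: "norm2 y > 0"
    using assms(2) norm2_nonneg[of y] by (simp add: less_le)
  have 1: "norm2 (x / y) = 1"
    using assms by (simp add: norm2_divide)
  then have "x / y \<noteq> 0"
    by auto
  then obtain q where q: "norm2 (x / y - of_rat q) < 1" "rat_norm2 q = 1"
    using 1 norm2_of_rat_approx by metis
  have "norm2 (x / y - 1) \<le> max (norm2 (x / y - of_rat q)) (norm2 (of_rat (q - 1)))"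
    using norm2_ultrametric[of "x / y - of_rat q" "of_rat (q - 1)"] by (simp add: of_rat_diff)
  also have "\<dots> < 1"
    using q rat_norm2_diff_1[OF q(2)] by (simp add: norm2_of_rat)
  finally have "norm2 ((x / y - 1) * y) < norm2 y"
    using y by (simp add: norm2_mult)
  then show ?thesis
    using assms(2) by (simp add: algebra_simps)
qed

lemma norm2_diff_le_half:
  assumes "norm2 x = norm2 y"
  shows "norm2 (x - y) \<le> norm2 y / 2"
  using assms norm2_diff_less[THEN norm2_le_half, of x y] by (cases "y = 0") auto

lemma norm2_add_le_half:
  assumes "norm2 x = norm2 y"
  shows "norm2 (x + y) \<le> norm2 y / 2"
  using norm2_diff_le_half[of x "- y"] assms by simp

section \<open>Balls in a dyadic sphere\<close>

lemma dist_q2_ultrametric: "dist (x::q2) z \<le> max (dist x y) (dist y z)"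
  using norm2_ultrametric[of "x - y" "y - z"] by (simp add: dist_q2_def)

lemma cball_q2_eq:
  assumes "dist (c::q2) d \<le> \<rho>"
  shows "cball c \<rho> = cball d \<rho>"
proof (intro set_eqI)
  show "x \<in> cball c \<rho> \<longleftrightarrow> x \<in> cball d \<rho>" for x
    using assms dist_q2_ultrametric[of c x d] dist_q2_ultrametric[of d x c]
    by (auto simp: dist_commute max_def split: if_splits)
qed

text \<open>With a residue field of two elements, a ball consists of only two balls of half the
  radius. Writing the radius as \<open>norm2 e\<close> makes it an attained value and supplies the
  centre \<open>c + e\<close> of the second half.\<close>

lemma cball_q2_split:
  assumes "e \<noteq> 0"
  shows "cball c (norm2 e) = cball c (norm2 e / 2) \<union> cball (c + e) (norm2 e / 2)"
    and "cball c (norm2 e / 2) \<inter> cball (c + e) (norm2 e / 2) = {}"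
proof -
  have e: "norm2 e > 0"
    using assms norm2_nonneg[of e] by (simp add: less_le)
  show "cball c (norm2 e) = cball c (norm2 e / 2) \<union> cball (c + e) (norm2 e / 2)"
  proof (intro subset_antisym subsetI)
    fix x assume "x \<in> cball c (norm2 e)"
    then consider "norm2 (x - c) < norm2 e" | "norm2 (x - c) = norm2 e"
      unfolding cball_q2 by force
    then show "x \<in> cball c (norm2 e / 2) \<union> cball (c + e) (norm2 e / 2)"
      using norm2_le_half[of "x - c" e] norm2_diff_le_half[of "x - c" e]
      by cases (auto simp: cball_q2 diff_diff_eq)
  next
    fix x assume "x \<in> cball c (norm2 e / 2) \<union> cball (c + e) (norm2 e / 2)"
    then show "x \<in> cball c (norm2 e)"
      using norm2_ultrametric[of "x - (c + e)" e] e
      by (auto simp: cball_q2)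
  qed
  show "cball c (norm2 e / 2) \<inter> cball (c + e) (norm2 e / 2) = {}"
  proof (intro equals0I)
    fix x assume "x \<in> cball c (norm2 e / 2) \<inter> cball (c + e) (norm2 e / 2)"
    then show False
      using norm2_diff_ultrametric[of "x - c" "x - (c + e)"] e
      by (auto simp: cball_q2)
  qed
qed

text \<open>Special to p = 2: elements of equal absolute value differ by at most half of it.\<close>

lemma sphere_q2_eq_cball:
  assumes "c \<in> sphere (0::q2) r" "r > 0"
  shows "sphere (0::q2) r = cball c (r / 2)"
proof (intro subset_antisym subsetI)
  fix x :: q2 assume "x \<in> sphere 0 r"
  then show "x \<in> cball c (r / 2)"
    using assms norm2_diff_le_half[of x c] by (simp add: sphere_q2 cball_q2)
next
  fix x assume "x \<in> cball c (r / 2)"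
  then show "x \<in> sphere 0 r"
    using assms norm2_add_eq_right[of "x - c" c] by (simp add: sphere_q2 cball_q2)
qed

section \<open>Balls as generators of the Borel sets of the sphere\<close>

declare mem_sphere [simp del]

text \<open>The exponent \<open>Suc n\<close> makes n = 0 the ball of radius r/2, which is the whole
  sphere.\<close>

definition sphere_balls :: "real \<Rightarrow> q2 set set" where
  "sphere_balls r = {cball c (r / 2 ^ Suc n) | c n. c \<in> sphere 0 r}"

lemma sphere_balls_subset:
  assumes "r > 0"
  shows "sphere_balls r \<subseteq> Pow (sphere 0 r)"
proof -
  have "cball c (r / 2 ^ Suc n) \<subseteq> sphere 0 r" if "c \<in> sphere 0 r" for c :: q2 and n
  proof -
    have "r / 2 ^ Suc n \<le> r / 2"
      using assms by (simp add: field_simps)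
    then show ?thesis
      unfolding sphere_q2_eq_cball[OF that assms] by (rule subset_cball)
  qed
  then show ?thesis
    by (auto simp: sphere_balls_def simp del: power_Suc)
qed

text \<open>Every point of an ultrametric ball is a centre of it, so two balls are nested or
  disjoint; the empty set covers the disjoint case.\<close>

lemma Int_stable_sphere_balls: "Int_stable (insert {} (sphere_balls r))"
proof -
  have *: "cball c \<rho> \<inter> cball d \<sigma> \<in> {{}, cball c \<rho>}" if "\<rho> \<le> \<sigma>" for c d :: q2 and \<rho> \<sigma>
  proof (cases "cball c \<rho> \<inter> cball d \<sigma> = {}")
    case False
    then obtain x where x: "x \<in> cball c \<rho>" "x \<in> cball d \<sigma>"
      by blast
    have "cball c \<rho> = cball x \<rho>" "cball d \<sigma> = cball x \<sigma>"
      using x by (auto intro!: cball_q2_eq)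
    with that show ?thesis
      by auto
  qed simp
  have "A \<inter> B \<in> insert {} (sphere_balls r)" if "A \<in> sphere_balls r" "B \<in> sphere_balls r" for A B
  proof -
    obtain c \<rho> d \<sigma> where "A = cball c \<rho>" "B = cball d \<sigma>"
      using \<open>A \<in> sphere_balls r\<close> \<open>B \<in> sphere_balls r\<close> by (auto simp: sphere_balls_def)
    then have "A \<inter> B \<in> {{}, A, B}"
      using *[of \<rho> \<sigma> c d] *[of \<sigma> \<rho> d c] by (cases "\<rho> \<le> \<sigma>") (auto simp: Int_commute)
    with that show ?thesis
      by auto
  qed
  then show ?thesis
    by (auto simp: Int_stable_def)
qed

lemma sets_sphere_q2:
  assumes "r > 0"
  shows "sets (restrict_space borel (sphere (0::q2) r)) = sigma_sets (sphere 0 r) (insert {} (sphere_balls r))"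
    (is "sets ?M = sigma_sets ?S ?E")
proof
  have E: "?E \<subseteq> Pow ?S"
    using sphere_balls_subset[OF assms] by auto
  have S_eq: "?S = (\<Union>c\<in>?S. ball c r)"
  proof (intro subset_antisym UN_least subsetI)
    fix x assume "x \<in> ?S"
    then show "x \<in> (\<Union>c\<in>?S. ball c r)"
      using assms by (intro UN_I[of x]) auto
  next
    fix c x assume "c \<in> ?S" "x \<in> ball c r"
    then show "x \<in> ?S"
      using norm2_add_eq_right[of "x - c" c]
      by (simp add: sphere_q2 dist_q2_def norm2_minus_commute)
  qed
  have "open ?S"
    by (subst S_eq) auto
  show "sigma_sets ?S ?E \<subseteq> sets ?M"
  proof -
    have "A \<in> sets ?M" if "A \<in> sphere_balls r" for A
    proof -
      have "A \<subseteq> ?S" "A \<in> sets borel"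
        using that sphere_balls_subset[OF assms] by (auto simp: sphere_balls_def)
      then show ?thesis
        by (auto simp: sets_restrict_space)
    qed
    then show ?thesis
      using sets.sigma_sets_subset[of ?E ?M] by (simp add: space_restrict_space subset_eq)
  qed
  show "sets ?M \<subseteq> sigma_sets ?S ?E"
  proof
    fix B assume "B \<in> sets ?M"
    then obtain A where A: "A \<in> sigma_sets UNIV {U. open (U::q2 set)}" "B = ?S \<inter> A"
      by (auto simp: sets_restrict_space borel_def)
    have "?S \<inter> A \<in> sets (sigma ?S ?E)"
      using A(1)
    proof induction
      case (Basic U)
      \<comment> \<open>Rational centres keep the union countable. They suffice because a ball
        around \<open>x\<close> is also a ball around any rational point in it.\<close>
      define I where "I = {(q, n). of_rat q \<in> ?S \<inter> U \<and> cball (of_rat q) (r / 2 ^ Suc n) \<subseteq> ?S \<inter> U}"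
      have "?S \<inter> U = (\<Union>(q, n)\<in>I. cball (of_rat q) (r / 2 ^ Suc n))"
      proof (intro subset_antisym subsetI)
        fix x assume x: "x \<in> ?S \<inter> U"
        have "open (?S \<inter> U)"
          using \<open>open ?S\<close> Basic by auto
        with x obtain e where e: "e > 0" "ball x e \<subseteq> ?S \<inter> U"
          by (meson open_contains_ball)
        obtain n where n: "(1 / 2) ^ n < e / r"
          using real_arch_pow_inv[of "e / r" "1 / 2"] e assms by auto
        define \<rho> where "\<rho> = r / 2 ^ Suc n"
        have "\<rho> > 0" "\<rho> < e"
        proof -
          have "\<rho> < r * (1 / 2) ^ n"
            using assms by (simp add: \<rho>_def power_divide field_simps)
          also have "\<dots> < e"
            using n assms by (simp add: field_simps)
          finally show "\<rho> < e" .
        qed (use assms in \<open>simp add: \<rho>_def\<close>)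
        obtain q where q: "dist x (of_rat q) < \<rho>"
          using of_rat_dense_q2[OF \<open>\<rho> > 0\<close>] by blast
        have "cball (of_rat q) \<rho> = cball x \<rho>"
          using q by (intro cball_q2_eq) (simp add: dist_commute)
        also have "\<dots> \<subseteq> ball x e"
          using \<open>\<rho> < e\<close> by auto
        finally have "cball (of_rat q) \<rho> \<subseteq> ?S \<inter> U"
          using e by blast
        moreover have "of_rat q \<in> cball (of_rat q) \<rho>"
          using \<open>\<rho> > 0\<close> by simp
        ultimately have "(q, n) \<in> I"
          unfolding I_def \<rho>_def by blast
        moreover have "x \<in> cball (of_rat q) \<rho>"
          using q by (simp add: dist_commute)
        ultimately show "x \<in> (\<Union>(q, n)\<in>I. cball (of_rat q) (r / 2 ^ Suc n))"
          by (intro UN_I[of "(q, n)"]) (simp_all add: \<rho>_def)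
      qed (auto simp: I_def)
      moreover have "(\<Union>(q, n)\<in>I. cball (of_rat q) (r / 2 ^ Suc n)) \<in> sets (sigma ?S ?E)"
      proof (rule sets.countable_UN'')
        show "countable I"
          by simp
        fix i assume "i \<in> I"
        then have "(case i of (q, n) \<Rightarrow> cball (of_rat q) (r / 2 ^ Suc n)) \<in> ?E"
          by (auto simp: I_def sphere_balls_def)
        then show "(case i of (q, n) \<Rightarrow> cball (of_rat q) (r / 2 ^ Suc n)) \<in> sets (sigma ?S ?E)"
          using E by auto
      qed
      ultimately show ?case
        by metis
    next
      case (Compl A)
      have "?S \<inter> (UNIV - A) = space (sigma ?S ?E) - ?S \<inter> A"
        using E by (auto simp: space_measure_of)
      then show ?case
        using Compl by (metis sets.compl_sets)
    next
      case (Union A)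
      have "(\<Union>i. ?S \<inter> A i) \<in> sets (sigma ?S ?E)"
        using Union by blast
      then show ?case
        by (simp only: Int_UN_distrib)
    qed simp
    with A E show "B \<in> sigma_sets ?S ?E"
      by simp
  qed
qed

text \<open>Uniqueness of measures on an intersection-stable generator. The sphere is itself a
  generating ball, so it can serve as the constant exhausting sequence.\<close>

lemma measure_sphere_eqI:
  fixes M N :: "q2 measure"
  assumes "r > 0" "sphere (0::q2) r \<noteq> {}"
    and "sets M = sets (restrict_space borel (sphere 0 r))" "sets N = sets M"
    and "finite_measure M"
    and "\<And>c n. c \<in> sphere 0 r \<Longrightarrow>
           emeasure M (cball c (r / 2 ^ Suc n)) = emeasure N (cball c (r / 2 ^ Suc n))"
  shows "M = N"
proof (rule measure_eqI_generator_eq[OF Int_stable_sphere_balls[of r],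
      where \<Omega> = "sphere 0 r" and A = "\<lambda>_. sphere 0 r"])
  show "insert {} (sphere_balls r) \<subseteq> Pow (sphere 0 r)"
    using sphere_balls_subset[OF assms(1)] by auto
  show "sets M = sigma_sets (sphere 0 r) (insert {} (sphere_balls r))"
    "sets N = sigma_sets (sphere 0 r) (insert {} (sphere_balls r))"
    using assms sets_sphere_q2 by auto
  show "emeasure M X = emeasure N X" if "X \<in> insert {} (sphere_balls r)" for X
    using that assms(6) by (auto simp: sphere_balls_def simp del: power_Suc)
  show "range (\<lambda>_::nat. sphere 0 r) \<subseteq> insert {} (sphere_balls r)"
  proof -
    obtain c where "c \<in> sphere (0::q2) r"
      using assms(2) by blast
    then have "sphere 0 r = cball c (r / 2 ^ Suc 0)"
      using sphere_q2_eq_cball assms(1) by simp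
    then show ?thesis
      using \<open>c \<in> sphere 0 r\<close> unfolding sphere_balls_def by blast
  qed
  show "emeasure M (sphere 0 r) \<noteq> \<infinity>"
    using finite_measure.emeasure_finite[OF assms(5)] by simp
qed auto

lemma emeasure_haar_cball:
  assumes "normalized_haar_sphere r \<mu>" "r > 0" "c \<in> sphere 0 r"
  shows "emeasure \<mu> (cball c (r / 2 ^ Suc n)) = ennreal (1 / 2 ^ n)"
proof -
  interpret prob_space \<mu>
    using assms(1) by (simp add: normalized_haar_sphere_def)
  have "c \<noteq> 0" "norm2 c = r"
    using assms by (auto simp: sphere_q2)
  \<comment> \<open>A nonempty sphere forces r to be a power of 2, and
    \<open>normalized_haar_sphere\<close> fixes the measure only of balls with such radii.\<close>
  then obtain k where k: "r = 2 powi k"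
    using norm2_powi by metis
  have rho: "r / 2 ^ Suc n = 2 powi (k - int (Suc n))"
    unfolding k by (subst power_int_diff) (simp_all only: power_int_of_nat, simp)
  have "cball c (r / 2 ^ Suc n) \<subseteq> sphere 0 r"
    using sphere_balls_subset[OF assms(2)] assms(3) by (auto simp: sphere_balls_def)
  then have "measure \<mu> (cball c (r / 2 ^ Suc n)) = (r / 2 ^ Suc n) / (r * (1 - 1 / 2))"
    using assms(1) unfolding normalized_haar_sphere_def rho by blast
  also have "\<dots> = 1 / 2 ^ n"
    using assms(2) by simp
  finally show ?thesis
    by (simp add: emeasure_eq_measure)
qed

section \<open>Isometries of a dyadic sphere close to the identity\<close>

text \<open>The constant 1/4 in \<open>quarter\<close> serves the doubling of displacements: the
  error |d|/4 must stay below |2d| = |d|/2. For the isometry any constant below 1 would do.\<close>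

locale near_identity =
  fixes r :: real and f :: "q2 \<Rightarrow> q2"
  assumes r_pos: "r > 0"
    and maps: "x \<in> sphere 0 r \<Longrightarrow> f x \<in> sphere 0 r"
    and displacement: "x \<in> sphere 0 r \<Longrightarrow> norm2 (f x - x) = r / 2"
    and quarter: "x \<in> sphere 0 r \<Longrightarrow> y \<in> sphere 0 r \<Longrightarrow>
      norm2 ((f x - f y) - (x - y)) \<le> norm2 (x - y) / 4"
begin

lemma isometry:
  assumes "x \<in> sphere 0 r" "y \<in> sphere 0 r"
  shows "dist (f x) (f y) = dist x y"
proof (cases "x = y")
  case False
  then have "norm2 (x - y) > 0"
    using norm2_nonneg[of "x - y"] by (simp add: less_le)
  then show ?thesis
    using quarter[OF assms] norm2_add_eq_right[of "(f x - f y) - (x - y)" "x - y"]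
    by (simp add: dist_q2_def)
qed simp

lemma funpow_maps: "x \<in> sphere 0 r \<Longrightarrow> (f ^^ k) x \<in> sphere 0 r"
  by (induction k) (auto simp: maps)

lemma funpow_isometry:
  "x \<in> sphere 0 r \<Longrightarrow> y \<in> sphere 0 r \<Longrightarrow> dist ((f ^^ k) x) ((f ^^ k) y) = dist x y"
  by (induction k) (simp_all add: isometry funpow_maps)

text \<open>Each step adds an error of at most |x - y|/4, because the iterates keep their distance;
  by the ultrametric inequality these errors do not accumulate.\<close>

lemma funpow_quarter:
  assumes "x \<in> sphere 0 r" "y \<in> sphere 0 r"
  shows "norm2 (((f ^^ k) x - (f ^^ k) y) - (x - y)) \<le> norm2 (x - y) / 4"
proof (induction k)
  case (Suc k)
  let ?x = "(f ^^ k) x" and ?y = "(f ^^ k) y"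
  have "norm2 ((f ?x - f ?y) - (?x - ?y)) \<le> norm2 (x - y) / 4"
    using quarter[of ?x ?y] funpow_maps funpow_isometry[OF assms, of k] assms
    by (simp add: dist_q2_def)
  then have "norm2 (((f ?x - f ?y) - (?x - ?y)) + ((?x - ?y) - (x - y))) \<le> norm2 (x - y) / 4"
    using Suc by (intro norm2_ultrametric[THEN order_trans]) simp
  moreover have "((f ?x - f ?y) - (?x - ?y)) + ((?x - ?y) - (x - y))
      = ((f ^^ Suc k) x - (f ^^ Suc k) y) - (x - y)"
    by simp
  ultimately show ?case
    by metis
qed (simp add: norm2_nonneg)

text \<open>If \<open>d = f\<^sup>m(x) - x\<close>, then \<open>f\<^sup>2\<^sup>m(x) - x\<close> equals \<open>2d\<close> up to an error of size \<open>|d|/4 < |2d|\<close>.\<close>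

lemma displacement_funpow:
  assumes "x \<in> sphere 0 r"
  shows "norm2 ((f ^^ (2 ^ n)) x - x) = r / 2 ^ Suc n"
proof (induction n)
  case 0
  then show ?case
    using displacement[OF assms] by simp
next
  case (Suc n)
  let ?g = "f ^^ (2 ^ n)"
  define d where "d = ?g x - x"
  have d: "norm2 d > 0" "norm2 d = r / 2 ^ Suc n"
    using Suc r_pos by (auto simp: d_def)
  have "norm2 ((?g (?g x) - ?g x) - d) \<le> norm2 d / 4"
    unfolding d_def by (rule funpow_quarter[OF funpow_maps[OF assms] assms])
  also have "\<dots> < norm2 (2 * d)"
    using d by (simp add: norm2_mult norm2_2)
  finally have "norm2 ((?g (?g x) - ?g x) - d + 2 * d) = norm2 (2 * d)"
    by (rule norm2_add_eq_right)
  also have "(?g (?g x) - ?g x) - d + 2 * d = ?g (?g x) - x"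
    by (simp add: d_def)
  also have "?g (?g x) = (f ^^ (2 ^ Suc n)) x"
    by (simp only: power_Suc mult_2 funpow_add comp_apply)
  finally show ?case
    using d by (simp add: norm2_mult norm2_2)
qed

text \<open>Successive halving of the distance to \<open>y\<close>. If an orbit point z is at
  distance exactly r/2^(n+1), then 2^n further steps move it to some w with |w - z| equal to |z -
  y|, and the sum w - y of two such elements is at most half as large. A smaller distance is at most
  half already.\<close>

lemma orbit_meets_cball:
  assumes "x \<in> sphere 0 r" "y \<in> sphere 0 r"
  shows "\<exists>k. dist ((f ^^ k) x) y \<le> r / 2 ^ Suc n"
proof (induction n)
  case 0
  have "dist ((f ^^ 0) x) y \<le> r / 2 ^ Suc 0"
    using assms norm2_diff_le_half[of x y] by (simp add: dist_q2_def sphere_q2)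
  then show ?case
    by blast
next
  case (Suc n)
  then obtain k where k: "dist ((f ^^ k) x) y \<le> r / 2 ^ Suc n"
    by blast
  define z where "z = (f ^^ k) x"
  let ?w = "(f ^^ (2 ^ n)) z"
  have w: "norm2 (?w - z) = r / 2 ^ Suc n"
    using displacement_funpow funpow_maps[OF assms(1)] by (simp add: z_def)
  consider "norm2 (z - y) < norm2 (?w - z)" | "norm2 (z - y) = norm2 (?w - z)"
    using k w by (fastforce simp: z_def dist_q2_def)
  then show ?case
  proof cases
    case 1
    then have "dist ((f ^^ k) x) y \<le> r / 2 ^ Suc (Suc n)"
      using norm2_le_half[OF 1] w by (simp add: z_def dist_q2_def)
    then show ?thesis
      by blast
  next
    case 2
    then have "dist ((f ^^ (2 ^ n + k)) x) y \<le> r / 2 ^ Suc (Suc n)"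
      using norm2_add_le_half[OF 2] w by (simp add: z_def dist_q2_def funpow_add)
    then show ?thesis
      by blast
  qed
qed

lemma vimage_cball:
  assumes "d \<in> sphere 0 r"
  shows "f -` cball (f d) (r / 2 ^ Suc n) \<inter> sphere 0 r = cball d (r / 2 ^ Suc n)"
proof -
  have "cball d (r / 2 ^ Suc n) \<subseteq> sphere 0 r"
    using sphere_balls_subset[OF r_pos] assms by (auto simp: sphere_balls_def)
  then show ?thesis
    using isometry[OF assms] by auto
qed

text \<open>The point \<open>d = f\<^sup>k(c)\<close> with \<open>k = 2\<^sup>n - 1\<close> is mapped into the ball, since \<open>f\<^sup>k\<^sup>+\<^sup>1\<close> moves \<open>c\<close> by
  exactly the radius.\<close>

lemma vimage_cball_ex:
  assumes "c \<in> sphere 0 r"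
  obtains d where "d \<in> sphere 0 r"
    "f -` cball c (r / 2 ^ Suc n) \<inter> sphere 0 r = cball d (r / 2 ^ Suc n)"
proof -
  define d where "d = (f ^^ (2 ^ n - 1)) c"
  have d: "d \<in> sphere 0 r"
    unfolding d_def by (rule funpow_maps[OF assms])
  have "Suc (2 ^ n - 1) = 2 ^ n"
    by simp
  then have "f d = (f ^^ (2 ^ n)) c"
    unfolding d_def by (metis comp_apply funpow.simps(2))
  then have "dist (f d) c \<le> r / 2 ^ Suc n"
    using displacement_funpow[OF assms, of n] by (simp add: dist_q2_def)
  then have "cball (f d) (r / 2 ^ Suc n) = cball c (r / 2 ^ Suc n)"
    by (rule cball_q2_eq)
  then show ?thesis
    using that d vimage_cball[OF d] by metis
qed

section \<open>Invariance of the Haar measure and ergodicity\<close>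

context
  fixes \<mu> :: "q2 measure"
  assumes haar: "normalized_haar_sphere r \<mu>"
begin

lemma prob_space_haar: "prob_space \<mu>"
  using haar by (simp add: normalized_haar_sphere_def)

lemma sets_haar: "sets \<mu> = sets (restrict_space borel (sphere 0 r))"
  using haar by (simp add: normalized_haar_sphere_def)

lemma space_haar: "space \<mu> = sphere 0 r"
  using sets_eq_imp_space_eq[OF sets_haar] by (simp add: space_restrict_space)

lemma sphere_nonempty: "sphere (0::q2) r \<noteq> {}"
  using prob_space.not_empty[OF prob_space_haar] space_haar by simp

lemma cball_sets_haar:
  assumes "c \<in> sphere 0 r"
  shows "cball c (r / 2 ^ Suc n) \<in> sets \<mu>"
  unfolding sets_haar sets_sphere_q2[OF r_pos]
  using assms by (intro sigma_sets.Basic insertI2) (auto simp: sphere_balls_def)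

lemma measurable_haar: "f \<in> measurable \<mu> \<mu>"
proof (rule measurable_sigma_sets)
  show "sets \<mu> = sigma_sets (sphere 0 r) (insert {} (sphere_balls r))"
    using sets_haar sets_sphere_q2[OF r_pos] by simp
  show "insert {} (sphere_balls r) \<subseteq> Pow (sphere 0 r)"
    using sphere_balls_subset[OF r_pos] by auto
  show "f \<in> space \<mu> \<rightarrow> sphere 0 r"
    using maps space_haar by auto
  fix A assume "A \<in> insert {} (sphere_balls r)"
  then show "f -` A \<inter> space \<mu> \<in> sets \<mu>"
    unfolding sphere_balls_def space_haar
    using vimage_cball_ex cball_sets_haar by (auto simp del: power_Suc) metis
qed

text \<open>The preimage of a ball is a ball of the same radius, hence of the same measure, and
  balls determine the measure.\<close>

lemma distr_haar: "distr \<mu> \<mu> f = \<mu>"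
proof (rule sym, rule measure_sphere_eqI[OF r_pos sphere_nonempty sets_haar])
  show "finite_measure \<mu>"
    using prob_space_haar by (simp add: prob_space_def)
  fix c :: q2 and n assume c: "c \<in> sphere 0 r"
  obtain d where d: "d \<in> sphere 0 r"
    "f -` cball c (r / 2 ^ Suc n) \<inter> sphere 0 r = cball d (r / 2 ^ Suc n)"
    using vimage_cball_ex[OF c] .
  show "emeasure \<mu> (cball c (r / 2 ^ Suc n)) = emeasure (distr \<mu> \<mu> f) (cball c (r / 2 ^ Suc n))"
    using c d emeasure_haar_cball[OF haar r_pos]
    by (simp add: emeasure_distr measurable_haar cball_sets_haar space_haar del: power_Suc)
qed simp

text \<open>A ball splits into two halves, and the orbit of \<open>c\<close> leads from one to the
  other. Invariance of \<open>V\<close> and of \<mu> gives \<open>V\<close> equal shares in both, so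
  each halving of the radius halves the share.\<close>

lemma invariant_set_cball:
  assumes V: "V \<in> sets \<mu>" "f -` V \<inter> space \<mu> = V" and c: "c \<in> sphere 0 r"
  shows "measure \<mu> (V \<inter> cball c (r / 2 ^ Suc n)) = measure \<mu> V / 2 ^ n"
  using c
proof (induction n arbitrary: c)
  case 0
  have "V \<inter> cball c (r / 2 ^ Suc 0) = V"
    using sphere_q2_eq_cball[OF 0 r_pos] sets.sets_into_space[OF V(1)] space_haar by auto
  then show ?case
    by simp
next
  case (Suc n)
  interpret prob_space \<mu>
    by (rule prob_space_haar)
  let ?B = "\<lambda>d. cball d (r / 2 ^ Suc (Suc n))"
  have step: "measure \<mu> (V \<inter> ?B d) = measure \<mu> (V \<inter> ?B (f d))" if "d \<in> sphere 0 r" for d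
  proof -
    have "V \<inter> ?B d = f -` (V \<inter> ?B (f d)) \<inter> space \<mu>"
      using V(2) vimage_cball[OF that, of "Suc n"] space_haar by blast
    moreover have "V \<inter> ?B (f d) \<in> sets \<mu>"
      by (intro sets.Int V(1) cball_sets_haar maps that)
    ultimately show ?thesis
      using measure_distr[OF measurable_haar] distr_haar by metis
  qed
  have orbit: "measure \<mu> (V \<inter> ?B d) = measure \<mu> (V \<inter> ?B ((f ^^ k) d))" if "d \<in> sphere 0 r" for d k
    using step funpow_maps[OF that] by (induction k) auto
  \<comment> \<open>This displacement has absolute value equal to the radius, so
    \<open>c + e\<close> is a centre of the half not containing \<open>c\<close>.\<close>
  define e where "e = (f ^^ (2 ^ n)) c - c"
  have e: "norm2 e = r / 2 ^ Suc n" "e \<noteq> 0"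
    using displacement_funpow[OF Suc.prems, of n] r_pos by (auto simp: e_def)
  have ce: "c + e \<in> sphere 0 r"
    using funpow_maps[OF Suc.prems] by (simp add: e_def)
  obtain k where "dist ((f ^^ k) c) (c + e) \<le> r / 2 ^ Suc (Suc n)"
    using orbit_meets_cball[OF Suc.prems ce] by blast
  then have "?B ((f ^^ k) c) = ?B (c + e)"
    by (rule cball_q2_eq)
  then have eq: "measure \<mu> (V \<inter> ?B (c + e)) = measure \<mu> (V \<inter> ?B c)"
    using orbit[OF Suc.prems, of k] by simp
  have "measure \<mu> (V \<inter> cball c (r / 2 ^ Suc n)) = measure \<mu> ((V \<inter> ?B c) \<union> (V \<inter> ?B (c + e)))"
    using cball_q2_split(1)[OF e(2), of c] by (simp add: e(1) Int_Un_distrib mult.commute)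
  also have "\<dots> = measure \<mu> (V \<inter> ?B c) + measure \<mu> (V \<inter> ?B (c + e))"
    using cball_q2_split(2)[OF e(2), of c]
    by (intro finite_measure_Union sets.Int V(1) cball_sets_haar Suc.prems ce)
       (auto simp: e(1) mult.commute)
  finally show ?case
    using Suc.IH[OF Suc.prems] eq by simp
qed

theorem ergodic: "ergodic \<mu> f"
  unfolding ergodic_def
proof (intro ballI impI)
  interpret prob_space \<mu>
    by (rule prob_space_haar)
  fix V assume V: "V \<in> sets \<mu>" "f -` V \<inter> space \<mu> = V"
  \<comment> \<open>\<open>M\<close> sends A to \<mu>(V \<inter> A) and \<open>N\<close> sends A to
    \<mu>(V) \<mu>(A), so the independence of \<open>V\<close> from all balls extends to Borel sets
    as an equality of measures.\<close>
  define M where "M = density \<mu> (indicator V)"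
  define N where "N = scale_measure (ennreal (measure \<mu> V)) \<mu>"
  have M: "emeasure M A = ennreal (measure \<mu> (V \<inter> A))" if "A \<in> sets \<mu>" for A
    using that V(1) by (simp add: M_def emeasure_restricted emeasure_eq_measure)
  have N: "emeasure N A = ennreal (measure \<mu> V * measure \<mu> A)" for A
    by (simp add: N_def emeasure_eq_measure ennreal_mult)
  have "M = N"
  proof (rule measure_sphere_eqI[OF r_pos sphere_nonempty])
    have "space M = space \<mu>"
      by (simp add: M_def)
    then show "finite_measure M"
      using M[OF sets.top] by (intro finite_measureI) simp
    fix c :: q2 and n assume c: "c \<in> sphere 0 r"
    have "measure \<mu> (cball c (r / 2 ^ Suc n)) = 1 / 2 ^ n"
      using emeasure_haar_cball[OF haar r_pos c, of n]
      by (simp add: measure_def del: power_Suc)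
    then show "emeasure M (cball c (r / 2 ^ Suc n)) = emeasure N (cball c (r / 2 ^ Suc n))"
      using invariant_set_cball[OF V c, of n]
      by (simp add: M[OF cball_sets_haar[OF c]] N del: power_Suc)
  qed (simp_all add: M_def N_def sets_haar)
  then have "measure \<mu> V * measure \<mu> V = measure \<mu> V"
    using M[OF V(1)] N[of V] by simp
  then show "measure \<mu> V = 0 \<or> measure \<mu> V = 1"
    by auto
qed

end

end

section \<open>The rational map\<close>

theorem theorem9:
  fixes a b s x1 x2 :: q2 and \<alpha> \<beta> :: real and \<mu> :: "q2 measure"
  assumes "a * b \<noteq> 0"
    and "s\<^sup>2 = a\<^sup>2 - 4 * b"
    and "x1 = (- a + s) / 2" and "x2 = (- a - s) / 2"
    and "\<alpha> = norm2 x1" and "\<beta> = norm2 x2"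
    and "4 * \<alpha> \<le> \<beta>"
    and "normalized_haar_sphere (\<beta> / 2) \<mu>"
  shows "ergodic \<mu> (ratfun a b)"
proof -
  define r where "r = \<beta> / 2"
  have a: "a = - (x1 + x2)" and b: "b = x1 * x2"
    using assms(2) by (simp_all add: assms(3,4) field_simps power2_eq_square)
  have "x1 \<noteq> 0" "x2 \<noteq> 0"
    using assms(1) b by auto
  then have "\<alpha> > 0" "\<beta> > 0"
    using assms(5,6) norm2_nonneg[of x1] norm2_nonneg[of x2] by (auto simp: less_le)
  have "r > 0"
    using \<open>\<beta> > 0\<close> by (simp add: r_def)
  \<comment> \<open>Here \<alpha> < \<beta>, so \<open>x2\<close> dominates the sum of the
    roots.\<close>
  have na: "norm2 a = 2 * r"
    unfolding a using norm2_add_eq_right[of x1 x2] assms(5-7) \<open>\<alpha> > 0\<close> norm2_minus[of "x1 + x2"]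
    by (simp add: r_def)
  have nb: "norm2 b \<le> r * r"
  proof -
    have "\<alpha> * \<beta> \<le> \<beta> / 4 * \<beta>"
      using assms(7) \<open>\<beta> > 0\<close> by (intro mult_right_mono) auto
    then show ?thesis
      by (simp add: b norm2_mult r_def flip: assms(5,6))
  qed
  \<comment> \<open>On the sphere the term \<open>a * x\<close> dominates \<open>b\<close>, so the
    denominator has constant absolute value and the pole is avoided.\<close>
  have den: "norm2 (a * x + b) = 2 * r * r" if "norm2 x = r" for x
  proof -
    have "norm2 b < norm2 (a * x)"
      using nb mult_pos_pos[OF \<open>r > 0\<close> \<open>r > 0\<close>] by (simp add: norm2_mult na that)
    from norm2_add_eq_right[OF this] show ?thesis
      by (simp add: norm2_mult na that add.commute)
  qed
  have den_nz: "a * x + b \<noteq> 0" if "norm2 x = r" for x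
    using den[OF that] \<open>r > 0\<close> by auto
  define h where "h = (\<lambda>x. x ^ 3 / (a * x + b))"
  have f: "ratfun a b x = h x + x" if "norm2 x = r" for x
    using den_nz[OF that] by (simp add: ratfun_def h_def field_simps power2_eq_square power3_eq_cube)
  have nh: "norm2 (h x) = r / 2" if "norm2 x = r" for x
    using \<open>r > 0\<close> by (simp add: h_def norm2_divide norm2_mult den that power3_eq_cube)
  have hh: "norm2 (h x - h y) \<le> norm2 (x - y) / 4" if "norm2 x = r" "norm2 y = r" for x y
  proof -
    \<comment> \<open>The cofactor of \<open>x - y\<close> in x^3 (a y + b) - y^3 (a x + b).\<close>
    define p where "p = a * x * y * (x + y) + b * (x * x + x * y + y * y)"
    have "h x - h y = (x - y) * p / ((a * x + b) * (a * y + b))"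
      unfolding h_def diff_frac_eq[OF den_nz[OF that(1)] den_nz[OF that(2)]]
      by (rule arg_cong2[where f = "(/)"]) (simp_all add: p_def algebra_simps power3_eq_cube)
    then have eq: "norm2 (h x - h y) = norm2 (x - y) * norm2 p / (2 * r * r * (2 * r * r))"
      using that by (simp add: norm2_divide norm2_mult den)
    \<comment> \<open>The factor 1/2 gained here brings the first summand of \<open>p\<close> down
      from 2 r^4 to r^4; against the denominator 4 r^4 this yields the constant 1/4.\<close>
    have "norm2 (x + y) \<le> r / 2"
      using norm2_add_le_half[of x y] that by simp
    then have 1: "norm2 (a * x * y * (x + y)) \<le> 2 * r * r * r * (r / 2)"
      using that \<open>r > 0\<close> unfolding norm2_mult na by (intro mult_mono) (auto simp: norm2_nonneg)
    have "norm2 (x * x + x * y + y * y) \<le> r * r"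
      using norm2_ultrametric[of "x * x + x * y" "y * y"] norm2_ultrametric[of "x * x" "x * y"] that
      by (simp add: norm2_mult)
    then have 2: "norm2 (b * (x * x + x * y + y * y)) \<le> r * r * (r * r)"
      using nb unfolding norm2_mult by (intro mult_mono) (auto simp: norm2_nonneg)
    have "norm2 p \<le> r * r * r * r"
      using norm2_ultrametric[of "a * x * y * (x + y)" "b * (x * x + x * y + y * y)"] 1 2
      by (simp add: p_def mult.assoc)
    then have "norm2 (x - y) * norm2 p \<le> norm2 (x - y) * (r * r * r * r)"
      by (intro mult_left_mono norm2_nonneg)
    then show ?thesis
      using \<open>r > 0\<close> unfolding eq by (simp add: field_simps)
  qed
  interpret near_identity r "ratfun a b"
  proof
    show "ratfun a b x \<in> sphere 0 r" if "x \<in> sphere 0 r" for x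
      using that nh[of x] norm2_add_eq_right[of "h x" x] \<open>r > 0\<close> by (simp add: sphere_q2 f)
    show "norm2 (ratfun a b x - x) = r / 2" if "x \<in> sphere 0 r" for x
      using that nh by (simp add: sphere_q2 f)
    show "norm2 ((ratfun a b x - ratfun a b y) - (x - y)) \<le> norm2 (x - y) / 4"
      if "x \<in> sphere 0 r" "y \<in> sphere 0 r" for x y
      using that hh by (simp add: sphere_q2 f)
  qed (fact \<open>r > 0\<close>)
  show ?thesis
    using ergodic assms(8) by (simp add: r_def)
qed

end
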